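(* Let $\gamma\in\{1,-1\}$, $\sigma\in(0,3/2]$, and let $a_n>0$, $b_n\in\mathbb R$ ($n\in\mathbb Z_+$) satisfy, as $n\to\infty$, $$a_n=n^\sigma(1+\alpha n^{-1}+O(n^{-2})),\qquad b_n=2\gamma n^\sigma(1+\beta n^{-1}+O(n^{-2})),$$ with $\alpha,\beta\in\mathbb R$; put $\tau=2\beta-2\alpha+\sigma$. If $\sigma>1$, suppose additionally that $\tau\ne0$. Then the minimal Jacobi operator $J_{\min}$ in $\ell^2(\mathbb Z_+)$ is essentially self-adjoint.
   Context: $\mathbb Z_+=\{0,1,2,\dots\}$. The minimal Jacobi operator $J_{\min}$ is defined on the set of finitely supported sequences $u=(u_n)\in\ell^2(\mathbb Z_+)$ by $(J_{\min}u)_0=b_0u_0+a_0u_1$ and $(J_{\min}u)_n=a_{n-1}u_{n-1}+b_nu_n+a_nu_{n+1}$ for $n\ge1$. *)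

theory Defs
  imports Complex_Main "HOL-Library.Landau_Symbols"
begin

text \<open>The complex Hilbert space of square-summable sequences indexed by $\{0,1,2,\dots\}$,
  with inner product linear in the first argument.\<close>

definition ell2 :: "(nat \<Rightarrow> complex) set" where
  "ell2 = {u. summable (\<lambda>n. (cmod (u n))\<^sup>2)}"

definition ell2_inner :: "(nat \<Rightarrow> complex) \<Rightarrow> (nat \<Rightarrow> complex) \<Rightarrow> complex" where
  "ell2_inner u v = (\<Sum>n. u n * cnj (v n))"

definition ell2_norm :: "(nat \<Rightarrow> complex) \<Rightarrow> real" where
  "ell2_norm u = sqrt (\<Sum>n. (cmod (u n))\<^sup>2)"

text \<open>A (possibly unbounded) operator is represented by its graph, so that its domain is the
  relational \<^const>\<open>Domain\<close>, and equality of graphs includes equality of domains.\<close>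

type_synonym ell2_graph = "((nat \<Rightarrow> complex) \<times> (nat \<Rightarrow> complex)) set"

definition linear_operator :: "ell2_graph \<Rightarrow> bool" where
  "linear_operator T \<longleftrightarrow>
     T \<subseteq> ell2 \<times> ell2 \<and> single_valued T \<and> (\<lambda>n. 0, \<lambda>n. 0) \<in> T \<and>
     (\<forall>(x, y) \<in> T. \<forall>(x', y') \<in> T. (\<lambda>n. x n + x' n, \<lambda>n. y n + y' n) \<in> T) \<and>
     (\<forall>c. \<forall>(x, y) \<in> T. (\<lambda>n. c * x n, \<lambda>n. c * y n) \<in> T)"

definition densely_defined :: "ell2_graph \<Rightarrow> bool" where
  "densely_defined T \<longleftrightarrow>
     (\<forall>v \<in> ell2. \<forall>e > 0. \<exists>u \<in> Domain T. ell2_norm (\<lambda>n. v n - u n) < e)"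

definition symmetric_operator :: "ell2_graph \<Rightarrow> bool" where
  "symmetric_operator T \<longleftrightarrow> linear_operator T \<and> densely_defined T \<and>
     (\<forall>(x, y) \<in> T. \<forall>(x', y') \<in> T. ell2_inner y x' = ell2_inner x y')"

text \<open>For a densely defined operator this is the graph of the usual adjoint operator.\<close>

definition adjoint_graph :: "ell2_graph \<Rightarrow> ell2_graph" where
  "adjoint_graph T =
     {(v, w). v \<in> ell2 \<and> w \<in> ell2 \<and> (\<forall>(x, y) \<in> T. ell2_inner y v = ell2_inner x w)}"

definition self_adjoint_operator :: "ell2_graph \<Rightarrow> bool" where
  "self_adjoint_operator T \<longleftrightarrow>
     linear_operator T \<and> densely_defined T \<and> adjoint_graph T = T"

definition closure_graph :: "ell2_graph \<Rightarrow> ell2_graph" where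
  "closure_graph T =
     {(u, v). u \<in> ell2 \<and> v \<in> ell2 \<and>
        (\<exists>x y. (\<forall>k::nat. (x k, y k) \<in> T) \<and>
           (\<lambda>k. ell2_norm (\<lambda>n. x k n - u n)) \<longlonglongrightarrow> 0 \<and>
           (\<lambda>k. ell2_norm (\<lambda>n. y k n - v n)) \<longlonglongrightarrow> 0)}"

text \<open>Closability is included: \<^const>\<open>self_adjoint_operator\<close> requires the closure of the graph
  to be single-valued.\<close>

definition essentially_self_adjoint :: "ell2_graph \<Rightarrow> bool" where
  "essentially_self_adjoint T \<longleftrightarrow>
     symmetric_operator T \<and> self_adjoint_operator (closure_graph T)"

definition jacobi_apply ::
  "(nat \<Rightarrow> real) \<Rightarrow> (nat \<Rightarrow> real) \<Rightarrow> (nat \<Rightarrow> complex) \<Rightarrow> nat \<Rightarrow> complex" where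
  "jacobi_apply a b u n =
     (if n = 0 then of_real (b 0) * u 0 + of_real (a 0) * u 1
      else of_real (a (n - 1)) * u (n - 1) + of_real (b n) * u n + of_real (a n) * u (n + 1))"

definition J_min :: "(nat \<Rightarrow> real) \<Rightarrow> (nat \<Rightarrow> real) \<Rightarrow> ell2_graph" where
  "J_min a b = {(u, jacobi_apply a b u) | u. finite {n. u n \<noteq> 0}}"

end

theory Submission
  imports Defs "HOL-Analysis.Analysis" "HOL-Real_Asymp.Real_Asymp"
begin

text \<open>The proof shows directly that finitely supported sequences form a core of the maximal
  operator \<open>J_max\<close>, which acts by the Jacobi matrix on all \<open>v\<close> in $\ell^2$ whose image is again
  in $\ell^2$. Testing against unit vectors shows that the adjoint of any extension of \<open>J_min\<close> is
  contained in \<open>J_max\<close>. Once the closure of \<open>J_min\<close> equals \<open>J_max\<close>, Green's formula extends to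
  \<open>J_max\<close> by continuity, and \<open>J_max\<close> is its own adjoint (\<open>essentially_self_adjoint_if_core\<close>).

  Put $s = -\gamma$ and $D_n = v_{n+1} - s v_n$. Since $b_n \approx -2 s a_n$, the matrix is a discrete
  Sturm--Liouville operator in disguise:
  \[(Jv)_n = a_n D_n - s\, a_{n-1} D_{n-1} + q_n v_n, \qquad q_n = b_n + s (a_n + a_{n-1}).\]
  For $\sigma \le 3/2$ the expansions of $a$ and $b$ give
  $a_n - a_{n-1} = O(n^{1/2})$ and $b_n + 2 s a_n = O(n^{1/2})$; hence $q_n = O(n^{1/2})$ and
  $a_n = O(n^{3/2})$. Essential self-adjointness rests on these growth bounds
  (\<open>critical_growth_essentially_self_adjoint\<close>).

  Given $v$ in the domain of \<open>J_max\<close>, approximate it by $\chi v$, where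
  $\chi_n = \max(0, 1 - n/L)^2$ and $L \to \infty$. With $d_n = \chi_{n+1} - \chi_n$, the error
  $J(\chi v) - \chi J v$ has two parts. One is $s (a_n d_n - a_{n-1} d_{n-1}) v_n$, whose
  coefficient is $O(L^{-1/2})$ because $d_n = O(1/L)$ and the second differences of $\chi$ are
  $O(1/L^2)$ (\<open>curvature_term_le\<close>). The other consists of the terms $a_n d_n D_n$ and
  $s\, a_{n-1} d_{n-1} D_{n-1}$. For these,
  $d_n^2 \le 4 \omega_n / L^2$ with $\omega_n = (\chi_n + \chi_{n+1})/2$, so their squares add up to at most
  $O(L^{-1/2})$ times the energy $\sum_{n<L} a_n \omega_n |D_n|^2$.

  Summation by parts in $\sum_n \chi_n (Jv)_n \overline{v_n}$ bounds that energy by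
  $K + 4C \sum_{n<L} (n+1)^{1/2} |v_n|^2$ (\<open>energy_bound\<close>). Divided by $L^{1/2}$ this tends to $0$
  by dominated convergence (\<open>energy_growth\<close>), so the error vanishes in the limit.
  This balance is where the critical exponent $3/2$ comes from: if $a_n$ is of order $n^{3/2}$, the
  squared gradient terms have size $L^{-1/2}$ relative to the energy, and the energy may grow almost as fast
  as $L^{1/2}$.\<close>

section \<open>Square-summable sequences\<close>

lemma norm_add_square_le:
  fixes x y :: "'a :: real_normed_vector"
  shows "(norm (x + y))\<^sup>2 \<le> 2 * (norm x)\<^sup>2 + 2 * (norm y)\<^sup>2"
proof -
  have "(norm (x + y))\<^sup>2 \<le> (norm x + norm y)\<^sup>2"
    by (simp add: norm_triangle_ineq power_mono)
  also have "\<dots> \<le> 2 * (norm x)\<^sup>2 + 2 * (norm y)\<^sup>2"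
    using sum_squares_bound [of "norm x" "norm y"] by (simp add: power2_sum)
  finally show ?thesis .
qed

lemma ell2_add:
  assumes "u \<in> ell2" "v \<in> ell2"
  shows "(\<lambda>n. u n + v n) \<in> ell2"
proof -
  have "summable (\<lambda>n. 2 * (cmod (u n))\<^sup>2 + 2 * (cmod (v n))\<^sup>2)"
    using assms by (auto simp: ell2_def intro!: summable_add summable_mult)
  then have "summable (\<lambda>n. (cmod (u n + v n))\<^sup>2)"
    by (rule summable_comparison_test'[where N = 0]) (simp add: norm_add_square_le)
  then show ?thesis by (simp add: ell2_def)
qed

lemma ell2_scale:
  assumes "u \<in> ell2"
  shows "(\<lambda>n. c * u n) \<in> ell2"
  using assms by (simp add: ell2_def norm_mult power_mult_distrib summable_mult)

lemma ell2_diff: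
  assumes "u \<in> ell2" "v \<in> ell2"
  shows "(\<lambda>n. u n - v n) \<in> ell2"
  using ell2_add[OF assms(1) ell2_scale[OF assms(2), of "- 1"]] by simp

lemma ell2_finite_support:
  assumes "finite {n. u n \<noteq> 0}"
  shows "u \<in> ell2"
  unfolding ell2_def using assms
  by (auto intro!: summable_finite[where N = "{n. u n \<noteq> 0}"])

lemma ell2_norm_nonneg: "u \<in> ell2 \<Longrightarrow> 0 \<le> ell2_norm u"
  by (auto simp: ell2_norm_def ell2_def intro!: suminf_nonneg)

lemma cmod_le_ell2_norm:
  assumes "u \<in> ell2"
  shows "cmod (u n) \<le> ell2_norm u"
proof -
  have "(\<Sum>k\<in>{n}. (cmod (u k))\<^sup>2) \<le> (\<Sum>k. (cmod (u k))\<^sup>2)"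
    using assms by (intro sum_le_suminf) (auto simp: ell2_def)
  then show ?thesis by (simp add: ell2_norm_def real_le_rsqrt)
qed

lemma ell2_inner_Cauchy_Schwarz:
  assumes "u \<in> ell2" "v \<in> ell2"
  shows "summable (\<lambda>n. u n * cnj (v n))"
    and "cmod (ell2_inner u v) \<le> ell2_norm u * ell2_norm v"
proof -
  have partial: "(\<Sum>n<N. cmod (u n * cnj (v n))) \<le> ell2_norm u * ell2_norm v" for N
  proof -
    have "L2_set (\<lambda>n. cmod (u n)) {..<N} \<le> ell2_norm u" "L2_set (\<lambda>n. cmod (v n)) {..<N} \<le> ell2_norm v"
      unfolding L2_set_def ell2_norm_def using assms
      by (auto simp: ell2_def intro!: sum_le_suminf)
    then have "L2_set (\<lambda>n. cmod (u n)) {..<N} * L2_set (\<lambda>n. cmod (v n)) {..<N}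
        \<le> ell2_norm u * ell2_norm v"
      using assms by (intro mult_mono) (auto simp: ell2_norm_nonneg)
    moreover have "(\<Sum>n<N. cmod (u n * cnj (v n))) = (\<Sum>n<N. \<bar>cmod (u n)\<bar> * \<bar>cmod (v n)\<bar>)"
      by (simp add: norm_mult)
    ultimately show ?thesis
      using L2_set_mult_ineq[of "\<lambda>n. cmod (u n)" "\<lambda>n. cmod (v n)" "{..<N}"] by linarith
  qed
  have abs: "summable (\<lambda>n. cmod (u n * cnj (v n)))"
    by (rule summableI_nonneg_bounded[OF _ partial]) auto
  then show "summable (\<lambda>n. u n * cnj (v n))" by (rule summable_norm_cancel)
  have "cmod (ell2_inner u v) \<le> (\<Sum>n. cmod (u n * cnj (v n)))"
    unfolding ell2_inner_def using abs by (rule summable_norm)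
  also have "\<dots> \<le> ell2_norm u * ell2_norm v"
    using abs partial by (rule suminf_le_const)
  finally show "cmod (ell2_inner u v) \<le> ell2_norm u * ell2_norm v" .
qed

lemma ell2_inner_diff_left:
  assumes "u \<in> ell2" "u' \<in> ell2" "v \<in> ell2"
  shows "ell2_inner (\<lambda>n. u n - u' n) v = ell2_inner u v - ell2_inner u' v"
  unfolding ell2_inner_def
  using suminf_diff[OF ell2_inner_Cauchy_Schwarz(1)[OF assms(1,3)]
      ell2_inner_Cauchy_Schwarz(1)[OF assms(2,3)]]
  by (simp add: algebra_simps)

lemma tendsto_ell2_inner_left:
  assumes "\<And>k. x k \<in> ell2" "u \<in> ell2" "v \<in> ell2"
    and lim: "(\<lambda>k. ell2_norm (\<lambda>n. x k n - u n)) \<longlonglongrightarrow> 0"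
  shows "(\<lambda>k. ell2_inner (x k) v) \<longlonglongrightarrow> ell2_inner u v"
proof -
  have "(\<lambda>k. ell2_norm (\<lambda>n. x k n - u n) * ell2_norm v) \<longlonglongrightarrow> 0"
    using tendsto_mult_right[OF lim, of "ell2_norm v"] by simp
  moreover have "cmod (ell2_inner (x k) v - ell2_inner u v)
      \<le> ell2_norm (\<lambda>n. x k n - u n) * ell2_norm v" for k
    using ell2_inner_Cauchy_Schwarz(2)[OF ell2_diff[OF assms(1)[of k] assms(2)] assms(3)]
      ell2_inner_diff_left[OF assms(1)[of k] assms(2,3)] by simp
  ultimately have "(\<lambda>k. ell2_inner (x k) v - ell2_inner u v) \<longlonglongrightarrow> 0"
    by (metis (no_types, lifting) Lim_null_comparison always_eventually)
  then show ?thesis by (simp add: LIM_zero_iff)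
qed

lemma tendsto_coordinate:
  assumes "\<And>k. x k \<in> ell2" "u \<in> ell2"
    and "(\<lambda>k. ell2_norm (\<lambda>n. x k n - u n)) \<longlonglongrightarrow> 0"
  shows "(\<lambda>k. x k n) \<longlonglongrightarrow> u n"
proof -
  have "cmod (x k n - u n) \<le> ell2_norm (\<lambda>n. x k n - u n)" for k
    using cmod_le_ell2_norm[OF ell2_diff[OF assms(1)[of k] assms(2)]] .
  then have "(\<lambda>k. x k n - u n) \<longlonglongrightarrow> 0"
    by (intro Lim_null_comparison[OF _ assms(3)]) (simp add: always_eventually)
  then show ?thesis by (simp add: LIM_zero_iff)
qed

text \<open>Dominated convergence, applied both to the cutoff error and to the growth of the energy.\<close>

lemma tendsto_weighted_suminf_zero:
  fixes \<theta> :: "nat \<Rightarrow> nat \<Rightarrow> real" and g :: "nat \<Rightarrow> real"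
  assumes "\<And>k n. 0 \<le> \<theta> k n" "\<And>k n. \<theta> k n \<le> 1" "\<And>n. (\<lambda>k. \<theta> k n) \<longlonglongrightarrow> 0"
    and g: "summable g" "\<And>n. 0 \<le> g n"
  shows "\<And>k. summable (\<lambda>n. \<theta> k n * g n)" "(\<lambda>k. \<Sum>n. \<theta> k n * g n) \<longlonglongrightarrow> 0"
proof -
  have le: "norm (\<theta> k n * g n) \<le> g n" for k n
    using assms(1,2)[of k n] g(2)[of n] by (simp add: abs_mult mult_left_le_one_le)
  show "summable (\<lambda>n. \<theta> k n * g n)" for k
    using le by (rule summable_comparison_test'[OF g(1), of 0])
  have lim: "(\<lambda>k. \<theta> k n * g n) \<longlonglongrightarrow> 0" for n
    using tendsto_mult_right[OF assms(3)[of n], of "g n"] by simp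
  have bound: "eventually (\<lambda>(n, k). norm (\<theta> k n * g n) \<le> g n) (at_top \<times>\<^sub>F sequentially)"
    using le by (intro always_eventually) auto
  have "(\<lambda>k. \<Sum>n. \<theta> k n * g n) \<longlonglongrightarrow> (\<Sum>n. 0)"
    using tannerys_theorem[where a = "\<lambda>n k. \<theta> k n * g n", OF lim bound g(1)
        trivial_limit_sequentially] by (elim conjE)
  then show "(\<lambda>k. \<Sum>n. \<theta> k n * g n) \<longlonglongrightarrow> 0" by simp
qed

text \<open>Truncations of a square-summable sequence converge to it.\<close>

lemma finite_support_dense:
  assumes "{u. finite {n. u n \<noteq> 0}} \<subseteq> Domain T"
  shows "densely_defined T"
  unfolding densely_defined_def
proof (intro ballI allI impI)
  fix v :: "nat \<Rightarrow> complex" and e :: real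
  assume v: "v \<in> ell2" and e: "e > 0"
  define \<theta> :: "nat \<Rightarrow> nat \<Rightarrow> real" where "\<theta> k n = (if n < k then 0 else 1)" for k n
  have "(\<lambda>k. \<theta> k n) \<longlonglongrightarrow> 0" for n
    by (rule tendsto_eventually)
      (auto simp: \<theta>_def eventually_sequentially intro!: exI[of _ "Suc n"])
  then have "(\<lambda>k. sqrt (\<Sum>n. \<theta> k n * (cmod (v n))\<^sup>2)) \<longlonglongrightarrow> sqrt 0"
    using v by (intro tendsto_real_sqrt tendsto_weighted_suminf_zero) (auto simp: \<theta>_def ell2_def)
  then obtain k where k: "sqrt (\<Sum>n. \<theta> k n * (cmod (v n))\<^sup>2) < e"
    using order_tendstoD(2)[of _ "sqrt 0" sequentially e] e eventually_happens by fastforce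
  define u where "u n = (if n < k then v n else 0)" for n
  have "finite {n. u n \<noteq> 0}"
    by (rule finite_subset[of _ "{..<k}"]) (auto simp: u_def)
  then have "u \<in> Domain T" using assms by blast
  moreover have "ell2_norm (\<lambda>n. v n - u n) = sqrt (\<Sum>n. \<theta> k n * (cmod (v n))\<^sup>2)"
    unfolding ell2_norm_def
    by (intro arg_cong[where f = sqrt] suminf_cong) (auto simp: u_def \<theta>_def)
  ultimately show "\<exists>u\<in>Domain T. ell2_norm (\<lambda>n. v n - u n) < e"
    using k by (metis (no_types))
qed

section \<open>The maximal Jacobi operator\<close>

text \<open>Off-diagonal coefficient to the left; the value 0 at the origin encodes the
  boundary condition, so that the first row of the matrix needs no separate treatment.\<close>

definition prev :: "(nat \<Rightarrow> real) \<Rightarrow> nat \<Rightarrow> real" where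
  "prev a n = (if n = 0 then 0 else a (n - 1))"

lemma prev_0 [simp]: "prev a 0 = 0" and prev_Suc [simp]: "prev a (Suc n) = a n"
  by (simp_all add: prev_def)

lemma jacobi_apply_prev:
  "jacobi_apply a b u n
     = of_real (prev a n) * u (n - 1) + of_real (b n) * u n + of_real (a n) * u (Suc n)"
  by (simp add: jacobi_apply_def prev_def)

definition J_max :: "(nat \<Rightarrow> real) \<Rightarrow> (nat \<Rightarrow> real) \<Rightarrow> ell2_graph" where
  "J_max a b = {(u, jacobi_apply a b u) | u. u \<in> ell2 \<and> jacobi_apply a b u \<in> ell2}"

lemma finite_support_jacobi_apply:
  assumes "finite {n. u n \<noteq> 0}"
  shows "finite {n. jacobi_apply a b u n \<noteq> 0}"
proof -
  obtain N where N: "\<And>n. n \<ge> N \<Longrightarrow> u n = 0"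
    using assms by (metis (mono_tags, lifting) finite_nat_set_iff_bounded mem_Collect_eq not_less)
  have "jacobi_apply a b u n = 0" if "n > N" for n
    using that by (simp add: jacobi_apply_prev N)
  then have "{n. jacobi_apply a b u n \<noteq> 0} \<subseteq> {..N}" by (auto simp: not_less[symmetric])
  then show ?thesis by (rule finite_subset) simp
qed

lemma J_min_subset_J_max: "J_min a b \<subseteq> J_max a b"
  by (auto simp: J_min_def J_max_def intro!: ell2_finite_support finite_support_jacobi_apply)

lemma jacobi_apply_linear:
  shows jacobi_apply_zero: "jacobi_apply a b (\<lambda>n. 0) = (\<lambda>n. 0)"
    and jacobi_apply_add:
      "jacobi_apply a b (\<lambda>n. x n + y n) = (\<lambda>n. jacobi_apply a b x n + jacobi_apply a b y n)"
    and jacobi_apply_scale: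
      "jacobi_apply a b (\<lambda>n. c * x n) = (\<lambda>n. c * jacobi_apply a b x n)"
  by (auto simp: jacobi_apply_prev algebra_simps)

lemma linear_operator_J_max: "linear_operator (J_max a b)"
  by (auto simp: linear_operator_def J_max_def single_valued_def jacobi_apply_linear
      ell2_finite_support ell2_add ell2_scale)

lemma linear_operator_J_min: "linear_operator (J_min a b)"
proof -
  have fin_add: "finite {n. x n + y n \<noteq> 0}" if "finite {n. x n \<noteq> 0}" "finite {n. y n \<noteq> 0}"
    for x y :: "nat \<Rightarrow> complex"
    by (rule finite_subset[OF _ finite_UnI[OF that]]) auto
  have fin_scale: "finite {n. c * x n \<noteq> 0}" if "finite {n. x n \<noteq> 0}"
    for x :: "nat \<Rightarrow> complex" and c
    by (rule finite_subset[OF _ that]) auto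
  have "J_min a b \<subseteq> ell2 \<times> ell2"
    by (auto simp: J_min_def intro!: ell2_finite_support finite_support_jacobi_apply)
  moreover have "(\<lambda>n. 0, \<lambda>n. 0) \<in> J_min a b"
    by (auto simp: J_min_def jacobi_apply_zero)
  moreover have "(\<lambda>n. x n + x' n, \<lambda>n. y n + y' n) \<in> J_min a b"
    if "(x, y) \<in> J_min a b" "(x', y') \<in> J_min a b" for x y x' y'
    using that fin_add by (auto simp: J_min_def jacobi_apply_add[symmetric])
  moreover have "(\<lambda>n. c * x n, \<lambda>n. c * y n) \<in> J_min a b"
    if "(x, y) \<in> J_min a b" for c x y
    using that fin_scale unfolding J_min_def by (fastforce simp: jacobi_apply_scale[symmetric])
  ultimately show ?thesis
    unfolding linear_operator_def by (fastforce simp: J_min_def single_valued_def)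
qed

text \<open>Green's formula: partial sums of the two sides differ by a Wronskian at the far end, which
  vanishes beyond the support of the first argument.\<close>

lemma green_formula:
  assumes "finite {n. x n \<noteq> 0}"
  shows "ell2_inner (jacobi_apply a b x) v = ell2_inner x (jacobi_apply a b v)"
proof -
  obtain N where N: "\<And>n. n \<ge> N \<Longrightarrow> x n = 0"
    using assms by (metis (mono_tags, lifting) finite_nat_set_iff_bounded mem_Collect_eq not_less)
  have wronskian: "(\<Sum>n<k. jacobi_apply a b x n * cnj (v n))
      = (\<Sum>n<k. x n * cnj (jacobi_apply a b v n))
        + prev a k * (x k * cnj (v (k - 1)) - x (k - 1) * cnj (v k))" for k
    by (induction k) (simp_all add: jacobi_apply_prev algebra_simps)
  have "jacobi_apply a b x n = 0" if "n \<ge> Suc N" for n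
    using that by (simp add: jacobi_apply_prev N)
  then have "ell2_inner (jacobi_apply a b x) v = (\<Sum>n<Suc N. jacobi_apply a b x n * cnj (v n))"
    unfolding ell2_inner_def by (intro suminf_finite) auto
  also have "\<dots> = (\<Sum>n<Suc N. x n * cnj (jacobi_apply a b v n))"
    unfolding wronskian by (simp add: N)
  also have "\<dots> = ell2_inner x (jacobi_apply a b v)"
    unfolding ell2_inner_def by (intro suminf_finite[symmetric]) (auto simp: N)
  finally show ?thesis .
qed

lemma symmetric_operator_J_min: "symmetric_operator (J_min a b)"
proof -
  have "densely_defined (J_min a b)"
    by (rule finite_support_dense) (auto simp: J_min_def)
  then show ?thesis
    using linear_operator_J_min by (auto simp: symmetric_operator_def J_min_def green_formula)
qed

text \<open>Testing against unit vectors shows that the adjoint acts by the same matrix.\<close>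

lemma adjoint_subset_J_max:
  assumes "J_min a b \<subseteq> T"
  shows "adjoint_graph T \<subseteq> J_max a b"
proof clarify
  fix v w assume "(v, w) \<in> adjoint_graph T"
  then have v: "v \<in> ell2" and w: "w \<in> ell2"
    and test: "\<And>x y. (x, y) \<in> T \<Longrightarrow> ell2_inner y v = ell2_inner x w"
    by (auto simp: adjoint_graph_def)
  have "jacobi_apply a b v n = w n" for n
  proof -
    define e :: "nat \<Rightarrow> complex" where "e k = (if k = n then 1 else 0)" for k
    have e: "finite {k. e k \<noteq> 0}"
      by (rule finite_subset[of _ "{n}"]) (auto simp: e_def)
    have pick: "ell2_inner e u = cnj (u n)" for u
      unfolding ell2_inner_def by (subst suminf_finite[of "{n}"]) (auto simp: e_def)
    have "(e, jacobi_apply a b e) \<in> T"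
      using assms e by (auto simp: J_min_def)
    from test[OF this] show ?thesis
      by (simp add: green_formula[OF e] pick)
  qed
  then have "jacobi_apply a b v = w" by auto
  then show "(v, w) \<in> J_max a b" using v w by (auto simp: J_max_def)
qed

text \<open>Both coordinates of the graph converge entrywise, and each row of the matrix is finite.\<close>

lemma closure_J_min_subset_J_max: "closure_graph (J_min a b) \<subseteq> J_max a b"
proof clarify
  fix u v assume "(u, v) \<in> closure_graph (J_min a b)"
  then obtain x y where u: "u \<in> ell2" and v: "v \<in> ell2"
    and xy: "\<And>k. (x k, y k) \<in> J_min a b"
    and x: "(\<lambda>k. ell2_norm (\<lambda>n. x k n - u n)) \<longlonglongrightarrow> 0"
    and y: "(\<lambda>k. ell2_norm (\<lambda>n. y k n - v n)) \<longlonglongrightarrow> 0"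
    by (auto simp: closure_graph_def)
  have xy': "x k \<in> ell2" "y k \<in> ell2" "y k = jacobi_apply a b (x k)" for k
    using xy[of k] J_min_subset_J_max by (fastforce simp: J_max_def)+
  note x_lim = tendsto_coordinate[OF xy'(1) u x] and y_lim = tendsto_coordinate[OF xy'(2) v y]
  have "(\<lambda>k. y k n) \<longlonglongrightarrow> jacobi_apply a b u n" for n
    unfolding xy'(3) jacobi_apply_prev by (intro tendsto_intros x_lim)
  then have "v n = jacobi_apply a b u n" for n
    using y_lim LIMSEQ_unique by blast
  then have "v = jacobi_apply a b u" by auto
  then show "(u, v) \<in> J_max a b" using u v by (auto simp: J_max_def)
qed

text \<open>Elements of \<^term>\<open>J_max a b\<close> are then limits of graph elements for which Green's formula holds, and
  the inner product is continuous; so \<^term>\<open>J_max a b\<close> is symmetric. Its adjoint is no larger, because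
  it contains \<^term>\<open>J_min a b\<close>.\<close>

lemma essentially_self_adjoint_if_core:
  assumes core: "J_max a b \<subseteq> closure_graph (J_min a b)"
  shows "essentially_self_adjoint (J_min a b)"
proof -
  have closure: "closure_graph (J_min a b) = J_max a b"
    using core closure_J_min_subset_J_max by blast
  have "J_max a b \<subseteq> adjoint_graph (J_max a b)"
  proof clarify
    fix v w assume "(v, w) \<in> J_max a b"
    then have v: "v \<in> ell2" and w: "w = jacobi_apply a b v" "w \<in> ell2"
      by (auto simp: J_max_def)
    have "ell2_inner g v = ell2_inner f w" if "(f, g) \<in> J_max a b" for f g
    proof -
      have "(f, g) \<in> closure_graph (J_min a b)" using that closure by simp
      then obtain x y where f: "f \<in> ell2" and g: "g \<in> ell2"
        and xy: "\<And>k. (x k, y k) \<in> J_min a b"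
        and x: "(\<lambda>k. ell2_norm (\<lambda>n. x k n - f n)) \<longlonglongrightarrow> 0"
        and y: "(\<lambda>k. ell2_norm (\<lambda>n. y k n - g n)) \<longlonglongrightarrow> 0"
        unfolding closure_graph_def by blast
      have xy': "x k \<in> ell2" "y k \<in> ell2" for k
        using xy[of k] J_min_subset_J_max by (fastforce simp: J_max_def)+
      have "ell2_inner (y k) v = ell2_inner (x k) w" for k
        using xy[of k] by (auto simp: J_min_def green_formula w)
      then show ?thesis
        using tendsto_ell2_inner_left[OF xy'(1) f w(2) x] tendsto_ell2_inner_left[OF xy'(2) g v y]
          LIMSEQ_unique by auto
    qed
    then show "(v, w) \<in> adjoint_graph (J_max a b)"
      using v w by (auto simp: adjoint_graph_def)
  qed
  then have "adjoint_graph (J_max a b) = J_max a b"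
    using adjoint_subset_J_max[OF J_min_subset_J_max] by blast
  moreover have "densely_defined (J_max a b)"
    by (rule finite_support_dense)
      (use J_min_subset_J_max[of a b] in \<open>fastforce simp: J_min_def\<close>)
  ultimately show ?thesis
    using symmetric_operator_J_min linear_operator_J_max
    by (auto simp: essentially_self_adjoint_def self_adjoint_operator_def closure)
qed

section \<open>A quadratic cutoff\<close>

definition ramp :: "nat \<Rightarrow> nat \<Rightarrow> real" where
  "ramp L n = max 0 (1 - real n / real L)"

text \<open>The square makes the profile continuously differentiable where it reaches 0, so that second
  differences are of order $1/L^2$ everywhere, while its square root is still Lipschitz with constant
  $1/L$. A linear profile would have a kink of size $1/L$ at $L$.\<close>

definition cutoff :: "nat \<Rightarrow> nat \<Rightarrow> real" where
  "cutoff L n = (ramp L n)\<^sup>2"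

definition cutoff_diff :: "nat \<Rightarrow> nat \<Rightarrow> real" where
  "cutoff_diff L n = cutoff L (Suc n) - cutoff L n"

definition cutoff_mean :: "nat \<Rightarrow> nat \<Rightarrow> real" where
  "cutoff_mean L n = (cutoff L n + cutoff L (Suc n)) / 2"

lemma ramp_bounds: "0 \<le> ramp L n" "ramp L n \<le> 1"
  by (auto simp: ramp_def)

lemma cutoff_bounds: "0 \<le> cutoff L n" "cutoff L n \<le> 1"
  using ramp_bounds[of L n] by (auto simp: cutoff_def power_le_one)

lemma cutoff_mean_nonneg: "0 \<le> cutoff_mean L n"
  using cutoff_bounds[of L n] cutoff_bounds[of L "Suc n"] by (simp add: cutoff_mean_def)

lemma ramp_eq_0: "L > 0 \<Longrightarrow> n \<ge> L \<Longrightarrow> ramp L n = 0"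
  by (auto simp: ramp_def field_simps)

lemma ramp_eq: "L > 0 \<Longrightarrow> n \<le> L \<Longrightarrow> ramp L n = 1 - real n / real L"
  by (auto simp: ramp_def field_simps)

lemma cutoff_eq_0: "L > 0 \<Longrightarrow> n \<ge> L \<Longrightarrow> cutoff L n = 0"
  by (simp add: cutoff_def ramp_eq_0)

lemma cutoff_diff_eq_0: "L > 0 \<Longrightarrow> n \<ge> L \<Longrightarrow> cutoff_diff L n = 0"
  by (simp add: cutoff_diff_def cutoff_eq_0)

lemma cutoff_tendsto_1: "(\<lambda>k. cutoff (Suc k) n) \<longlonglongrightarrow> 1"
proof -
  have "(\<lambda>k. real n / real (Suc k)) \<longlonglongrightarrow> 0"
    by real_asymp
  then have "(\<lambda>k. (max 0 (1 - real n / real (Suc k)))\<^sup>2) \<longlonglongrightarrow> (max 0 (1 - 0))\<^sup>2"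
    by (intro tendsto_intros)
  then show ?thesis by (simp add: cutoff_def ramp_def)
qed

lemma ramp_diff:
  assumes "L > 0"
  shows "\<bar>ramp L (Suc n) - ramp L n\<bar> \<le> 1 / real L"
proof (cases "n < L")
  case True
  then show ?thesis using assms by (simp add: ramp_eq field_simps)
next
  case False
  then show ?thesis using assms by (simp add: ramp_eq_0)
qed

lemma cutoff_diff_ramp:
  "cutoff_diff L n = (ramp L (Suc n) - ramp L n) * (ramp L (Suc n) + ramp L n)"
  by (simp add: cutoff_diff_def cutoff_def power2_eq_square algebra_simps)

text \<open>The gradient is controlled by the cutoff itself, because it factors as a difference of ramps, at
  most $1/L$, times a sum of ramps. This lets the same cutoff absorb the cross terms in the energy
  estimate and bound the gradient terms of the commutator by the energy.\<close>

lemma cutoff_diff_square_le: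
  assumes "L > 0"
  shows "(cutoff_diff L n)\<^sup>2 \<le> 4 * cutoff_mean L n / (real L)\<^sup>2"
proof -
  have 1: "(ramp L (Suc n) - ramp L n)\<^sup>2 \<le> (1 / real L)\<^sup>2"
    using ramp_diff[OF assms, of n] by (simp add: abs_le_square_iff[symmetric])
  have 2: "(ramp L (Suc n) + ramp L n)\<^sup>2 \<le> 4 * cutoff_mean L n"
    using sum_squares_bound[of "ramp L (Suc n)" "ramp L n"]
    by (simp add: cutoff_mean_def cutoff_def power2_sum)
  have "(cutoff_diff L n)\<^sup>2 = (ramp L (Suc n) - ramp L n)\<^sup>2 * (ramp L (Suc n) + ramp L n)\<^sup>2"
    by (simp add: cutoff_diff_ramp power_mult_distrib)
  also have "\<dots> \<le> (1 / real L)\<^sup>2 * (4 * cutoff_mean L n)"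
    using 1 2 by (intro mult_mono) auto
  finally show ?thesis by (simp add: power_divide)
qed

lemma abs_cutoff_diff_le:
  assumes "L > 0"
  shows "\<bar>cutoff_diff L n\<bar> \<le> 2 / real L"
proof -
  have "\<bar>ramp L (Suc n) - ramp L n\<bar> * \<bar>ramp L (Suc n) + ramp L n\<bar> \<le> (1 / real L) * 2"
    using ramp_diff[OF assms, of n] ramp_bounds[of L n] ramp_bounds[of L "Suc n"]
    by (intro mult_mono) auto
  then show ?thesis by (simp add: cutoff_diff_ramp abs_mult)
qed

lemma cutoff_second_diff_le:
  assumes "L > 0"
  shows "\<bar>cutoff_diff L (Suc n) - cutoff_diff L n\<bar> \<le> 2 / (real L)\<^sup>2"
proof -
  consider "Suc n < L" | "Suc n = L" | "n \<ge> L" by linarith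
  then show ?thesis
  proof cases
    case 1
    then have "cutoff_diff L (Suc n) - cutoff_diff L n = 2 / (real L)\<^sup>2"
      using assms by (simp add: cutoff_diff_ramp ramp_eq field_simps power2_eq_square)
    then show ?thesis by simp
  next
    case 2
    then have "cutoff_diff L (Suc n) - cutoff_diff L n = (ramp L n)\<^sup>2"
      using assms by (simp add: cutoff_diff_def cutoff_def ramp_eq_0)
    also have "ramp L n = 1 / real L"
      using 2 assms by (simp add: ramp_eq field_simps)
    finally show ?thesis by (simp add: power_divide divide_right_mono)
  next
    case 3
    then show ?thesis using assms by (simp add: cutoff_diff_eq_0)
  qed
qed

section \<open>The energy estimate\<close>

text \<open>Critical growth, normalised to one constant. With \<^term>\<open>prev\<close>, the increment bound at
  the origin reads $|a_0| \le C$, so that it also controls the size of the coefficients. The sign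
  \<open>s\<close> lets both signs of the diagonal be treated at once.\<close>

locale critical_jacobi =
  fixes a b :: "nat \<Rightarrow> real" and s C :: real
  assumes sign: "s * s = 1"
    and a_nonneg: "0 \<le> a n"
    and a_step: "\<bar>a n - prev a n\<bar> \<le> C * sqrt (real n + 1)"
    and b_near: "\<bar>b n + 2 * s * a n\<bar> \<le> C * sqrt (real n + 1)"
begin

text \<open>The discrete derivative adapted to the sign: for \<open>s = - 1\<close> it is the ordinary difference after
  alternating the signs of the entries.\<close>

definition twisted_diff :: "(nat \<Rightarrow> complex) \<Rightarrow> nat \<Rightarrow> complex" where
  "twisted_diff v n = v (Suc n) - of_real s * v n"

text \<open>What remains of the diagonal after the second-order part in divergence form is split off. The
  leading terms of \<open>b\<close> and of \<open>a\<close> cancel here.\<close>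

definition potential :: "nat \<Rightarrow> real" where
  "potential n = b n + s * (a n + prev a n)"

lemma abs_sign: "\<bar>s\<bar> = 1"
  using sign by (metis abs_mult_self_eq abs_1 abs_ge_zero abs_mult mult_cancel_left1 power2_eq_1_iff power2_eq_square abs_minus_cancel)

lemma sign_cancel: "complex_of_real s * (complex_of_real s * z) = z"
  using sign by (metis of_real_1 of_real_mult mult.assoc mult_1)

lemma C_nonneg: "0 \<le> C"
  using a_step[of 0] abs_ge_zero[of "a 0 - prev a 0"] by (simp del: abs_ge_zero)

lemma prev_nonneg: "0 \<le> prev a n"
  by (simp add: prev_def a_nonneg)

text \<open>Summing the increments, each at most $C L^{1/2}$ for indices below \<open>L\<close>.\<close>

lemma a_le: "n < L \<Longrightarrow> a n \<le> C * real L * sqrt (real L)"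
proof -
  have "a n \<le> C * (real n + 1) * sqrt (real n + 1)" for n
  proof (induction n)
    case 0
    then show ?case using a_step[of 0] by simp
  next
    case (Suc n)
    have "a n \<le> C * (real n + 1) * sqrt (real (Suc n) + 1)"
      using C_nonneg by (intro order.trans[OF Suc] mult_left_mono) auto
    moreover have "a (Suc n) \<le> a n + C * sqrt (real (Suc n) + 1)"
      using a_step[of "Suc n"] by (simp add: abs_le_iff)
    ultimately show ?case by (simp add: algebra_simps)
  qed
  moreover assume "n < L"
  then have "C * (real n + 1) * sqrt (real n + 1) \<le> C * real L * sqrt (real L)"
    using C_nonneg by (intro mult_mono) auto
  ultimately show ?thesis using order.trans by blast
qed

lemma abs_potential_le: "\<bar>potential n\<bar> \<le> 2 * C * sqrt (real n + 1)"
proof -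
  have "potential n = (b n + 2 * s * a n) - s * (a n - prev a n)"
    by (simp add: potential_def algebra_simps)
  also have "\<bar>\<dots>\<bar> \<le> \<bar>b n + 2 * s * a n\<bar> + \<bar>s\<bar> * \<bar>a n - prev a n\<bar>"
    by (metis abs_mult abs_triangle_ineq4)
  finally show ?thesis
    using a_step[of n] b_near[of n] by (simp add: abs_sign)
qed

lemma jacobi_apply_twisted:
  "jacobi_apply a b v n = of_real (a n) * twisted_diff v n
     - of_real (s * prev a n) * twisted_diff v (n - 1) + of_real (potential n) * v n"
proof -
  have s: "complex_of_real s * complex_of_real s = 1"
    using sign by (metis of_real_1 of_real_mult)
  show ?thesis
  proof (cases n)
    case 0
    then show ?thesis
      by (simp add: jacobi_apply_prev twisted_diff_def potential_def algebra_simps)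
  next
    case (Suc m)
    have "of_real s * (of_real (a m) * (of_real s * v m)) = (of_real (a m) * v m) * (of_real s * of_real s)"
      by (simp add: algebra_simps)
    then show ?thesis
      by (simp add: Suc jacobi_apply_prev twisted_diff_def potential_def algebra_simps s)
  qed
qed

text \<open>Summation by parts. The boundary term disappears when the weight vanishes at \<open>N\<close>.\<close>

lemma energy_identity:
  fixes w :: "nat \<Rightarrow> real"
  shows "(\<Sum>n<N. of_real (w n) * jacobi_apply a b v n * cnj (v n))
    = (\<Sum>n<N. of_real (w n * potential n) * (v n * cnj (v n)))
      - of_real s * (\<Sum>n<N. of_real (a n) * twisted_diff v n
          * cnj (of_real (w (Suc n)) * v (Suc n) - of_real (s * w n) * v n))
      + of_real (s * prev a N * w N) * twisted_diff v (N - 1) * cnj (v N)"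
proof (induction N)
  case 0
  then show ?case by simp
next
  case (Suc N)
  have "of_real (w N) * jacobi_apply a b v N * cnj (v N)
      = of_real (w N * potential N) * (v N * cnj (v N))
        - of_real s * (of_real (a N) * twisted_diff v N
          * cnj (of_real (w (Suc N)) * v (Suc N) - of_real (s * w N) * v N))
        + of_real (s * prev a (Suc N) * w (Suc N)) * twisted_diff v (Suc N - 1) * cnj (v (Suc N))
        - of_real (s * prev a N * w N) * twisted_diff v (N - 1) * cnj (v N)"
    by (simp add: jacobi_apply_twisted algebra_simps sign_cancel)
  then show ?case
    unfolding sum.lessThan_Suc Suc.IH by (simp add: distrib_left)
qed

text \<open>A symmetric product rule. Averaging the weight over the two ends of the edge is what keeps it
  comparable with the square of its difference even at the last edge of the support, where one of the
  two values is 0.\<close>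

lemma twisted_leibniz:
  fixes w w' :: real
  shows "of_real w' * v (Suc n) - of_real (s * w) * v n
    = of_real ((w + w') / 2) * twisted_diff v n
      + of_real ((w' - w) / 2) * (v (Suc n) + of_real s * v n)"
  by (simp add: twisted_diff_def field_simps)

definition energy :: "nat \<Rightarrow> (nat \<Rightarrow> complex) \<Rightarrow> real" where
  "energy L v = (\<Sum>n<L. a n * cutoff_mean L n * (cmod (twisted_diff v n))\<^sup>2)"

text \<open>Solving the energy identity for the quadratic form; the three sums come from $Jv$, from the
  potential and from the gradient of the cutoff.\<close>

lemma energy_terms:
  assumes "L > 0"
  shows "energy L v \<le> (\<Sum>n<L. cutoff L n * cmod (jacobi_apply a b v n) * cmod (v n))
     + (\<Sum>n<L. cutoff L n * \<bar>potential n\<bar> * (cmod (v n))\<^sup>2)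
     + (\<Sum>n<L. a n * \<bar>cutoff_diff L n\<bar> / 2 * cmod (twisted_diff v n) * (cmod (v (Suc n)) + cmod (v n)))"
proof -
  define A where "A = (\<Sum>n<L. of_real (cutoff L n) * jacobi_apply a b v n * cnj (v n))"
  define B where "B = (\<Sum>n<L. of_real (cutoff L n * potential n) * (v n * cnj (v n)))"
  define R where "R = (\<Sum>n<L. of_real (a n * cutoff_diff L n / 2) * twisted_diff v n
          * cnj (v (Suc n) + of_real s * v n))"
  have "of_real (a n) * twisted_diff v n
          * cnj (of_real (cutoff L (Suc n)) * v (Suc n) - of_real (s * cutoff L n) * v n)
      = of_real (a n * cutoff_mean L n * (cmod (twisted_diff v n))\<^sup>2)
        + of_real (a n * cutoff_diff L n / 2) * twisted_diff v n * cnj (v (Suc n) + of_real s * v n)"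
    (is "?lhs = ?rhs") for n
  proof -
    have "?lhs = of_real (a n) * twisted_diff v n
        * cnj (of_real (cutoff_mean L n) * twisted_diff v n
          + of_real (cutoff_diff L n / 2) * (v (Suc n) + of_real s * v n))"
      unfolding twisted_leibniz cutoff_mean_def cutoff_diff_def by (rule refl)
    also have "\<dots> = ?rhs"
      unfolding of_real_mult complex_norm_square by (simp add: algebra_simps)
    finally show ?thesis .
  qed
  then have "A = B - of_real s * (of_real (energy L v) + R)"
    using energy_identity[of "cutoff L" v L] cutoff_eq_0[OF assms order.refl]
    by (simp add: A_def B_def R_def energy_def sum.distrib)
  then have "of_real s * (of_real (energy L v) + R) = B - A" by simp
  then have "of_real s * (of_real s * (of_real (energy L v) + R)) = of_real s * (B - A)" by simp
  then have "of_real (energy L v) = of_real s * (B - A) - R"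
    unfolding sign_cancel by (simp add: algebra_simps)
  then have "cmod (of_real (energy L v)) \<le> cmod (of_real s * (B - A)) + cmod R"
    by (metis norm_triangle_ineq4)
  also have "cmod (of_real s * (B - A)) \<le> cmod A + cmod B"
    using norm_triangle_ineq4[of B A] by (simp add: norm_mult abs_sign)
  finally have "energy L v \<le> cmod A + cmod B + cmod R"
    by simp
  also have "cmod A \<le> (\<Sum>n<L. cutoff L n * cmod (jacobi_apply a b v n) * cmod (v n))"
    unfolding A_def by (rule sum_norm_le) (simp add: norm_mult cutoff_bounds)
  also have "cmod B \<le> (\<Sum>n<L. cutoff L n * \<bar>potential n\<bar> * (cmod (v n))\<^sup>2)"
    unfolding B_def by (rule sum_norm_le) (simp add: norm_mult cutoff_bounds abs_mult power2_eq_square)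
  also have "cmod R \<le> (\<Sum>n<L. a n * \<bar>cutoff_diff L n\<bar> / 2 * cmod (twisted_diff v n) * (cmod (v (Suc n)) + cmod (v n)))"
    unfolding R_def
  proof (rule sum_norm_le)
    fix n
    have "cmod (v (Suc n) + of_real s * v n) \<le> cmod (v (Suc n)) + cmod (v n)"
      using norm_triangle_ineq[of "v (Suc n)" "of_real s * v n"] by (simp add: norm_mult abs_sign)
    then have "a n * \<bar>cutoff_diff L n\<bar> / 2 * cmod (twisted_diff v n) * cmod (v (Suc n) + of_real s * v n)
      \<le> a n * \<bar>cutoff_diff L n\<bar> / 2 * cmod (twisted_diff v n) * (cmod (v (Suc n)) + cmod (v n))"
      by (intro mult_left_mono) (auto simp: a_nonneg)
    moreover have "cmod (complex_of_real (a n * cutoff_diff L n / 2)) = a n * \<bar>cutoff_diff L n\<bar> / 2"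
      by (simp only: norm_of_real) (simp add: abs_mult a_nonneg)
    ultimately show "cmod (of_real (a n * cutoff_diff L n / 2) * twisted_diff v n * cnj (v (Suc n) + of_real s * v n))
      \<le> a n * \<bar>cutoff_diff L n\<bar> / 2 * cmod (twisted_diff v n) * (cmod (v (Suc n)) + cmod (v n))"
      by (simp only: norm_mult complex_mod_cnj)
  qed
  finally show ?thesis by simp
qed

text \<open>The inequality between the means turns the cross term into half of the energy density plus a
  multiple of $a_n/L^2 \le C$ times $|v|^2$. The half is absorbed on the left in the energy bound.\<close>

lemma cross_term_le:
  assumes "L > 0" "n < L"
  shows "a n * \<bar>cutoff_diff L n\<bar> / 2 * cmod (twisted_diff v n) * (cmod (v (Suc n)) + cmod (v n))
    \<le> a n * cutoff_mean L n * (cmod (twisted_diff v n))\<^sup>2 / 2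
      + C * ((cmod (v (Suc n)))\<^sup>2 + (cmod (v n))\<^sup>2)"
proof -
  define x where "x = sqrt (cutoff_mean L n) * cmod (twisted_diff v n)"
  define y where "y = (cmod (v (Suc n)) + cmod (v n)) / real L"
  have "\<bar>cutoff_diff L n\<bar> \<le> sqrt (4 * cutoff_mean L n / (real L)\<^sup>2)"
    using cutoff_diff_square_le[OF assms(1), of n] by (intro real_le_rsqrt) simp
  then have d: "\<bar>cutoff_diff L n\<bar> / 2 \<le> sqrt (cutoff_mean L n) / real L"
    by (simp add: real_sqrt_divide real_sqrt_mult mult.commute)
  have "a n * \<bar>cutoff_diff L n\<bar> / 2 * cmod (twisted_diff v n) * (cmod (v (Suc n)) + cmod (v n))
      = a n * ((\<bar>cutoff_diff L n\<bar> / 2) * (cmod (twisted_diff v n) * (cmod (v (Suc n)) + cmod (v n))))"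
    by simp
  also have "\<dots> \<le> a n * ((sqrt (cutoff_mean L n) / real L) * (cmod (twisted_diff v n) * (cmod (v (Suc n)) + cmod (v n))))"
    by (intro mult_left_mono mult_right_mono d) (auto simp: a_nonneg)
  also have "\<dots> = a n * (x * y)" by (simp add: x_def y_def)
  also have "\<dots> \<le> a n * (x\<^sup>2 / 2 + y\<^sup>2 / 2)"
    using sum_squares_bound[of x y] by (intro mult_left_mono a_nonneg) simp
  finally have main: "a n * \<bar>cutoff_diff L n\<bar> / 2 * cmod (twisted_diff v n) * (cmod (v (Suc n)) + cmod (v n))
      \<le> a n * x\<^sup>2 / 2 + a n * y\<^sup>2 / 2" by (simp add: algebra_simps)
  have x2: "x\<^sup>2 = cutoff_mean L n * (cmod (twisted_diff v n))\<^sup>2"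
    by (simp add: x_def power_mult_distrib cutoff_mean_nonneg)
  have "sqrt (real L) \<le> real L"
    using assms by (intro real_le_lsqrt) (auto simp: power2_eq_square)
  then have "C * real L * sqrt (real L) \<le> C * real L * real L"
    using C_nonneg by (intro mult_left_mono) auto
  then have aL: "a n \<le> C * (real L)\<^sup>2"
    using a_le[OF assms(2)] by (simp add: power2_eq_square)
  have "a n * y\<^sup>2 = a n * (cmod (v (Suc n)) + cmod (v n))\<^sup>2 / (real L)\<^sup>2"
    by (simp add: y_def power_divide)
  also have "\<dots> \<le> (C * (real L)\<^sup>2) * (cmod (v (Suc n)) + cmod (v n))\<^sup>2 / (real L)\<^sup>2"
    by (intro divide_right_mono mult_right_mono aL) auto
  also have "\<dots> = C * (cmod (v (Suc n)) + cmod (v n))\<^sup>2" using assms(1) by simp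
  also have "\<dots> \<le> C * (2 * (cmod (v (Suc n)))\<^sup>2 + 2 * (cmod (v n))\<^sup>2)"
    using sum_squares_bound[of "cmod (v (Suc n))" "cmod (v n)"] C_nonneg
    by (intro mult_left_mono) (auto simp: power2_sum)
  finally have "a n * y\<^sup>2 / 2 \<le> C * ((cmod (v (Suc n)))\<^sup>2 + (cmod (v n))\<^sup>2)"
    by (simp add: algebra_simps)
  with main show ?thesis by (simp add: x2 mult.assoc)
qed

text \<open>Only the potential term can grow with \<open>L\<close>; the other contributions are bounded by the
  $\ell^2$ norms of \<open>v\<close> and of its image.\<close>

lemma energy_bound:
  assumes "v \<in> ell2" "jacobi_apply a b v \<in> ell2"
  obtains K where "0 \<le> K"
    and "\<And>L. L > 0 \<Longrightarrow> energy L v \<le> K + 4 * C * (\<Sum>n<L. sqrt (real n + 1) * (cmod (v n))\<^sup>2)"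
proof
  define V where "V = (\<Sum>n. (cmod (v n))\<^sup>2)"
  define F where "F = (\<Sum>n. (cmod (jacobi_apply a b v n))\<^sup>2)"
  have sV: "summable (\<lambda>n. (cmod (v n))\<^sup>2)" and sF: "summable (\<lambda>n. (cmod (jacobi_apply a b v n))\<^sup>2)"
    using assms by (auto simp: ell2_def)
  have V0: "0 \<le> V" "0 \<le> F" unfolding V_def F_def by (auto intro!: suminf_nonneg sV sF)
  show "0 \<le> F + V + 4 * C * V" using V0 C_nonneg by simp
  have V: "(\<Sum>n<L. (cmod (v n))\<^sup>2) \<le> V" and F: "(\<Sum>n<L. (cmod (jacobi_apply a b v n))\<^sup>2) \<le> F" for L
    unfolding V_def F_def by (auto intro!: sum_le_suminf sV sF)
  have V': "(\<Sum>n<L. (cmod (v (Suc n)))\<^sup>2) \<le> V" for L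
  proof -
    have "(\<Sum>n<L. (cmod (v (Suc n)))\<^sup>2) \<le> (\<Sum>n<Suc L. (cmod (v n))\<^sup>2)"
      unfolding sum.lessThan_Suc_shift by simp
    then show ?thesis using V[of "Suc L"] by linarith
  qed
  fix L :: nat assume L: "L > 0"
  let ?P = "\<Sum>n<L. sqrt (real n + 1) * (cmod (v n))\<^sup>2"
  have "(\<Sum>n<L. cutoff L n * cmod (jacobi_apply a b v n) * cmod (v n))
      \<le> (\<Sum>n<L. ((cmod (jacobi_apply a b v n))\<^sup>2 + (cmod (v n))\<^sup>2) / 2)"
  proof (rule sum_mono)
    fix n
    have "cutoff L n * (cmod (jacobi_apply a b v n) * cmod (v n)) \<le> cmod (jacobi_apply a b v n) * cmod (v n)"
      using cutoff_bounds[of L n] by (intro mult_left_le_one_le) auto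
    then show "cutoff L n * cmod (jacobi_apply a b v n) * cmod (v n)
        \<le> ((cmod (jacobi_apply a b v n))\<^sup>2 + (cmod (v n))\<^sup>2) / 2"
      using sum_squares_bound[of "cmod (jacobi_apply a b v n)" "cmod (v n)"] by simp
  qed
  also have "\<dots> = ((\<Sum>n<L. (cmod (jacobi_apply a b v n))\<^sup>2) + (\<Sum>n<L. (cmod (v n))\<^sup>2)) / 2"
    by (simp add: sum_divide_distrib[symmetric] sum.distrib)
  also have "\<dots> \<le> (F + V) / 2" using V[of L] F[of L] by simp
  finally have 1: "(\<Sum>n<L. cutoff L n * cmod (jacobi_apply a b v n) * cmod (v n)) \<le> (F + V) / 2" .
  have "(\<Sum>n<L. cutoff L n * \<bar>potential n\<bar> * (cmod (v n))\<^sup>2)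
      \<le> (\<Sum>n<L. 2 * C * (sqrt (real n + 1) * (cmod (v n))\<^sup>2))"
  proof (rule sum_mono)
    fix n
    have "cutoff L n * \<bar>potential n\<bar> \<le> 1 * (2 * C * sqrt (real n + 1))"
      using cutoff_bounds[of L n] abs_potential_le[of n] by (intro mult_mono) auto
    then have "cutoff L n * \<bar>potential n\<bar> * (cmod (v n))\<^sup>2 \<le> (1 * (2 * C * sqrt (real n + 1))) * (cmod (v n))\<^sup>2"
      by (rule mult_right_mono) simp
    then show "cutoff L n * \<bar>potential n\<bar> * (cmod (v n))\<^sup>2 \<le> 2 * C * (sqrt (real n + 1) * (cmod (v n))\<^sup>2)"
      by (simp add: mult.assoc)
  qed
  then have 2: "(\<Sum>n<L. cutoff L n * \<bar>potential n\<bar> * (cmod (v n))\<^sup>2) \<le> 2 * C * ?P"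
    by (simp add: sum_distrib_left)
  have "(\<Sum>n<L. a n * \<bar>cutoff_diff L n\<bar> / 2 * cmod (twisted_diff v n) * (cmod (v (Suc n)) + cmod (v n)))
      \<le> (\<Sum>n<L. a n * cutoff_mean L n * (cmod (twisted_diff v n))\<^sup>2 / 2
          + C * ((cmod (v (Suc n)))\<^sup>2 + (cmod (v n))\<^sup>2))"
    by (intro sum_mono cross_term_le[OF L]) simp
  also have "\<dots> = energy L v / 2 + C * ((\<Sum>n<L. (cmod (v (Suc n)))\<^sup>2) + (\<Sum>n<L. (cmod (v n))\<^sup>2))"
    by (simp add: energy_def sum.distrib sum_divide_distrib sum_distrib_left distrib_left)
  also have "\<dots> \<le> energy L v / 2 + C * (V + V)"
    using V[of L] V'[of L] C_nonneg by (intro add_left_mono mult_left_mono) auto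
  finally have 3: "(\<Sum>n<L. a n * \<bar>cutoff_diff L n\<bar> / 2 * cmod (twisted_diff v n) * (cmod (v (Suc n)) + cmod (v n)))
      \<le> energy L v / 2 + C * (V + V)" .
  show "energy L v \<le> F + V + 4 * C * V + 4 * C * ?P"
    using energy_terms[OF L, of v] 1 2 3 by (simp add: algebra_simps)
qed

text \<open>The weights $((n+1)/L)^{1/2}$ for $n < L$ are at most 1 and tend to 0 for fixed \<open>n\<close>, so the
  bound on the energy is of smaller order than $L^{1/2}$ by dominated convergence.\<close>

lemma energy_growth:
  assumes "v \<in> ell2" "jacobi_apply a b v \<in> ell2"
  shows "(\<lambda>k. energy (Suc k) v / sqrt (real (Suc k))) \<longlonglongrightarrow> 0"
proof -
  obtain K where K: "0 \<le> K"
    and bound: "\<And>L. L > 0 \<Longrightarrow> energy L v \<le> K + 4 * C * (\<Sum>n<L. sqrt (real n + 1) * (cmod (v n))\<^sup>2)"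
    using energy_bound[OF assms] by blast
  define \<theta> :: "nat \<Rightarrow> nat \<Rightarrow> real" where
    "\<theta> k n = (if n < Suc k then sqrt (real n + 1) / sqrt (real (Suc k)) else 0)" for k n
  have "(\<lambda>k. \<theta> k n) \<longlonglongrightarrow> 0" for n
  proof (rule Lim_null_comparison)
    show "(\<lambda>k. sqrt (real n + 1) / sqrt (real (Suc k))) \<longlonglongrightarrow> 0" by real_asymp
  qed (auto simp: \<theta>_def)
  then have "(\<lambda>k. \<Sum>n. \<theta> k n * (cmod (v n))\<^sup>2) \<longlonglongrightarrow> 0"
    using assms(1) by (intro tendsto_weighted_suminf_zero) (auto simp: \<theta>_def ell2_def)
  moreover have "(\<Sum>n. \<theta> k n * (cmod (v n))\<^sup>2)
      = (\<Sum>n<Suc k. sqrt (real n + 1) * (cmod (v n))\<^sup>2) / sqrt (real (Suc k))" for k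
    by (subst suminf_finite[of "{..<Suc k}"]) (auto simp: \<theta>_def sum_divide_distrib simp del: sum.lessThan_Suc)
  ultimately have P: "(\<lambda>k. (\<Sum>n<Suc k. sqrt (real n + 1) * (cmod (v n))\<^sup>2) / sqrt (real (Suc k))) \<longlonglongrightarrow> 0"
    by simp
  have "(\<lambda>k. K / sqrt (real (Suc k))) \<longlonglongrightarrow> 0" by real_asymp
  from tendsto_add[OF this tendsto_mult_right_zero[OF P, of "4 * C"]]
  have "(\<lambda>k. (K + 4 * C * (\<Sum>n<Suc k. sqrt (real n + 1) * (cmod (v n))\<^sup>2)) / sqrt (real (Suc k))) \<longlonglongrightarrow> 0"
    by (simp add: add_divide_distrib del: sum.lessThan_Suc)
  moreover have "norm (energy (Suc k) v / sqrt (real (Suc k)))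
      \<le> (K + 4 * C * (\<Sum>n<Suc k. sqrt (real n + 1) * (cmod (v n))\<^sup>2)) / sqrt (real (Suc k))" for k
  proof -
    have "0 \<le> energy (Suc k) v"
      unfolding energy_def by (intro sum_nonneg mult_nonneg_nonneg) (auto simp: a_nonneg cutoff_mean_nonneg)
    then show ?thesis using bound[of "Suc k"]
      by (simp add: divide_right_mono)
  qed
  ultimately show ?thesis
    by (metis (no_types, lifting) Lim_null_comparison always_eventually)
qed

section \<open>The commutator with the cutoff\<close>

definition commutator :: "nat \<Rightarrow> (nat \<Rightarrow> complex) \<Rightarrow> nat \<Rightarrow> complex" where
  "commutator L v n = jacobi_apply a b (\<lambda>m. of_real (cutoff L m) * v m) n
      - of_real (cutoff L n) * jacobi_apply a b v n"

text \<open>Both neighbours of $v_n$ are replaced by $s v_n$ and a twisted difference. The coefficients of $v_n$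
  then combine to a difference of $a_n d_n$, which is one order smaller than $a_n d_n$ itself.\<close>

lemma commutator_twisted:
  "commutator L v n = of_real (a n * cutoff_diff L n) * twisted_diff v n
     + of_real (s * (prev a n * cutoff_diff L (n - 1))) * twisted_diff v (n - 1)
     + of_real (s * (a n * cutoff_diff L n - prev a n * cutoff_diff L (n - 1))) * v n"
proof (cases n)
  case 0
  then show ?thesis
    by (simp add: commutator_def jacobi_apply_prev twisted_diff_def cutoff_diff_def algebra_simps)
next
  case (Suc m)
  then show ?thesis
    by (simp add: sign_cancel commutator_def jacobi_apply_prev twisted_diff_def cutoff_diff_def algebra_simps)
qed

lemma gradient_term_le:
  assumes "L > 0" "n < L"
  shows "(a n * cutoff_diff L n)\<^sup>2 \<le> 4 * C / sqrt (real L) * (a n * cutoff_mean L n)"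
proof -
  have "(a n * cutoff_diff L n)\<^sup>2 = a n * (a n * (cutoff_diff L n)\<^sup>2)"
    by (simp add: power2_eq_square)
  also have "\<dots> \<le> (C * real L * sqrt (real L)) * (a n * (4 * cutoff_mean L n / (real L)\<^sup>2))"
    using C_nonneg by (intro mult_mono a_le assms mult_left_mono cutoff_diff_square_le a_nonneg mult_nonneg_nonneg) auto
  also have "\<dots> = 4 * C * (a n * cutoff_mean L n) * (sqrt (real L) / real L)"
    using assms(1) by (simp add: power2_eq_square)
  also have "sqrt (real L) / real L = 1 / sqrt (real L)"
    using assms(1) by (simp add: sqrt_divide_self_eq inverse_eq_divide)
  finally show ?thesis by simp
qed

text \<open>A discrete product rule: $(a_n - a_{n-1}) d_n$ is at most $C L^{1/2} \cdot 2/L$ and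
  $a_{n-1} (d_n - d_{n-1})$ is at most $C L^{3/2} \cdot 2/L^2$.\<close>

lemma curvature_term_le:
  assumes "L > 0" "n \<le> L"
  shows "\<bar>a n * cutoff_diff L n - prev a n * cutoff_diff L (n - 1)\<bar> \<le> 4 * C / sqrt (real L)"
proof -
  have sq: "sqrt (real L) / real L = 1 / sqrt (real L)"
    using assms(1) by (simp add: sqrt_divide_self_eq inverse_eq_divide)
  have "\<bar>(a n - prev a n) * cutoff_diff L n\<bar> \<le> 2 * C / sqrt (real L)"
  proof (cases "n = L")
    case True
    then show ?thesis using assms(1) C_nonneg by (simp add: cutoff_diff_eq_0)
  next
    case False
    then have "C * sqrt (real n + 1) \<le> C * sqrt (real L)"
      using assms(2) C_nonneg by (intro mult_left_mono) auto
    then have "\<bar>a n - prev a n\<bar> \<le> C * sqrt (real L)"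
      using a_step[of n] by linarith
    then have "\<bar>a n - prev a n\<bar> * \<bar>cutoff_diff L n\<bar> \<le> (C * sqrt (real L)) * (2 / real L)"
      by (intro mult_mono abs_cutoff_diff_le assms) (use C_nonneg in auto)
    also have "\<dots> = 2 * C * (sqrt (real L) / real L)" by simp
    finally show ?thesis by (simp add: sq abs_mult)
  qed
  moreover have "\<bar>prev a n * (cutoff_diff L n - cutoff_diff L (n - 1))\<bar> \<le> 2 * C / sqrt (real L)"
  proof (cases n)
    case 0
    then show ?thesis using C_nonneg by simp
  next
    case (Suc m)
    have "prev a n * \<bar>cutoff_diff L n - cutoff_diff L (n - 1)\<bar>
        \<le> (C * real L * sqrt (real L)) * (2 / (real L)\<^sup>2)"
      unfolding Suc using assms(2) C_nonneg Suc
      by (intro mult_mono) (auto intro: a_le cutoff_second_diff_le[OF assms(1)])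
    also have "\<dots> = 2 * C * (sqrt (real L) / real L)"
      using assms(1) by (simp add: power2_eq_square)
    finally show ?thesis by (simp add: sq abs_mult prev_nonneg)
  qed
  moreover have "a n * cutoff_diff L n - prev a n * cutoff_diff L (n - 1)
      = (a n - prev a n) * cutoff_diff L n + prev a n * (cutoff_diff L n - cutoff_diff L (n - 1))"
    by (simp add: algebra_simps)
  ultimately show ?thesis by simp
qed

lemma commutator_eq_0:
  assumes "L > 0" "n > L"
  shows "commutator L v n = 0"
  using assms by (simp add: commutator_twisted cutoff_diff_eq_0)

text \<open>The first sum collects the gradient terms to the left and to the right of each site, the second the
  curvature term.\<close>

lemma commutator_sum_le:
  assumes "L > 0"
  shows "(\<Sum>n<Suc L. (cmod (commutator L v n))\<^sup>2)
    \<le> 32 * C * (energy L v / sqrt (real L)) + 64 * C\<^sup>2 / real L * (\<Sum>n<Suc L. (cmod (v n))\<^sup>2)"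
proof -
  define G where "G n = (cmod (of_real (a n * cutoff_diff L n) * twisted_diff v n))\<^sup>2" for n
  define G' where "G' n = (cmod (of_real (s * (prev a n * cutoff_diff L (n - 1))) * twisted_diff v (n - 1)))\<^sup>2" for n
  define E where "E n = (cmod (of_real (s * (a n * cutoff_diff L n - prev a n * cutoff_diff L (n - 1))) * v n))\<^sup>2" for n
  have three: "(cmod (commutator L v n))\<^sup>2 \<le> 4 * G n + 4 * G' n + 4 * E n" for n
  proof -
    let ?x = "of_real (a n * cutoff_diff L n) * twisted_diff v n"
    let ?y = "of_real (s * (prev a n * cutoff_diff L (n - 1))) * twisted_diff v (n - 1)"
    let ?z = "of_real (s * (a n * cutoff_diff L n - prev a n * cutoff_diff L (n - 1))) * v n"
    have "(cmod (?x + ?y + ?z))\<^sup>2 \<le> 2 * (cmod (?x + ?y))\<^sup>2 + 2 * (cmod ?z)\<^sup>2"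
      by (rule norm_add_square_le)
    moreover have "(cmod (?x + ?y))\<^sup>2 \<le> 2 * (cmod ?x)\<^sup>2 + 2 * (cmod ?y)\<^sup>2"
      by (rule norm_add_square_le)
    ultimately have "(cmod (?x + ?y + ?z))\<^sup>2 \<le> 4 * (cmod ?x)\<^sup>2 + 4 * (cmod ?y)\<^sup>2 + 4 * (cmod ?z)\<^sup>2"
      using zero_le_power2[of "cmod ?z"] by linarith
    then show ?thesis by (simp only: commutator_twisted G_def G'_def E_def)
  qed
  have "G n \<le> 4 * C / sqrt (real L) * (a n * cutoff_mean L n * (cmod (twisted_diff v n))\<^sup>2)" if "n < L" for n
  proof -
    have "G n = (a n * cutoff_diff L n)\<^sup>2 * (cmod (twisted_diff v n))\<^sup>2"
      unfolding G_def by (simp only: norm_mult norm_of_real power_mult_distrib power2_abs)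
    also have "\<dots> \<le> 4 * C / sqrt (real L) * (a n * cutoff_mean L n) * (cmod (twisted_diff v n))\<^sup>2"
      by (intro mult_right_mono gradient_term_le assms that) auto
    finally show ?thesis by (simp add: mult.assoc)
  qed
  then have "(\<Sum>n<L. G n) \<le> (\<Sum>n<L. 4 * C / sqrt (real L) * (a n * cutoff_mean L n * (cmod (twisted_diff v n))\<^sup>2))"
    by (intro sum_mono) auto
  then have G: "(\<Sum>n<L. G n) \<le> 4 * C * (energy L v / sqrt (real L))"
    unfolding sum_distrib_left[symmetric] by (simp add: energy_def)
  have "G L = 0" using assms by (simp add: G_def cutoff_diff_eq_0)
  then have G1: "(\<Sum>n<Suc L. G n) \<le> 4 * C * (energy L v / sqrt (real L))" using G by simp
  have "G' 0 = 0" "\<And>n. G' (Suc n) = G n"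
    by (auto simp: G_def G'_def norm_mult abs_sign)
  then have G2: "(\<Sum>n<Suc L. G' n) \<le> 4 * C * (energy L v / sqrt (real L))"
    using G by (simp add: sum.lessThan_Suc_shift del: sum.lessThan_Suc)
  have "E n \<le> 16 * C\<^sup>2 / real L * (cmod (v n))\<^sup>2" if "n < Suc L" for n
  proof -
    let ?e = "a n * cutoff_diff L n - prev a n * cutoff_diff L (n - 1)"
    have "\<bar>?e\<bar> \<le> 4 * C / sqrt (real L)" using curvature_term_le[OF assms, of n] that by simp
    then have "?e\<^sup>2 \<le> (4 * C / sqrt (real L))\<^sup>2"
      using power_mono[of "\<bar>?e\<bar>" _ 2] by simp
    also have "\<dots> = 16 * C\<^sup>2 / real L" by (simp add: power_divide power_mult_distrib)
    finally have "?e\<^sup>2 * (cmod (v n))\<^sup>2 \<le> 16 * C\<^sup>2 / real L * (cmod (v n))\<^sup>2"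
      by (rule mult_right_mono) simp
    moreover have "E n = ?e\<^sup>2 * (cmod (v n))\<^sup>2"
      unfolding E_def by (simp only: norm_mult norm_of_real power_mult_distrib power2_abs abs_mult abs_sign mult_1)
    ultimately show ?thesis by simp
  qed
  then have "(\<Sum>n<Suc L. E n) \<le> (\<Sum>n<Suc L. 16 * C\<^sup>2 / real L * (cmod (v n))\<^sup>2)"
    by (intro sum_mono) blast
  then have E: "(\<Sum>n<Suc L. E n) \<le> 16 * C\<^sup>2 / real L * (\<Sum>n<Suc L. (cmod (v n))\<^sup>2)"
    by (simp only: sum_distrib_left)
  have "(\<Sum>n<Suc L. (cmod (commutator L v n))\<^sup>2) \<le> (\<Sum>n<Suc L. 4 * G n + 4 * G' n + 4 * E n)"
    by (intro sum_mono three)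
  also have "\<dots> = 4 * (\<Sum>n<Suc L. G n) + 4 * (\<Sum>n<Suc L. G' n) + 4 * (\<Sum>n<Suc L. E n)"
    by (simp only: sum.distrib sum_distrib_left)
  also have "\<dots> \<le> 4 * (4 * C * (energy L v / sqrt (real L))) + 4 * (4 * C * (energy L v / sqrt (real L)))
      + 4 * (16 * C\<^sup>2 / real L * (\<Sum>n<Suc L. (cmod (v n))\<^sup>2))"
    using G1 G2 E by linarith
  finally show ?thesis by simp
qed

lemma commutator_tendsto_0:
  assumes "v \<in> ell2" "jacobi_apply a b v \<in> ell2"
  shows "(\<lambda>k. \<Sum>n. (cmod (commutator (Suc k) v n))\<^sup>2) \<longlonglongrightarrow> 0"
proof -
  define V where "V = (\<Sum>n. (cmod (v n))\<^sup>2)"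
  have eq: "(\<Sum>n. (cmod (commutator (Suc k) v n))\<^sup>2) = (\<Sum>n<Suc (Suc k). (cmod (commutator (Suc k) v n))\<^sup>2)" for k
    by (rule suminf_finite) (auto simp: commutator_eq_0)
  have "(\<lambda>k. 64 * C\<^sup>2 / real (Suc k) * V) \<longlonglongrightarrow> 0" by real_asymp
  from tendsto_add[OF tendsto_mult_right_zero[OF energy_growth[OF assms], of "32 * C"] this]
  have lim: "(\<lambda>k. 32 * C * (energy (Suc k) v / sqrt (real (Suc k))) + 64 * C\<^sup>2 / real (Suc k) * V) \<longlonglongrightarrow> 0"
    by simp
  have "norm (\<Sum>n. (cmod (commutator (Suc k) v n))\<^sup>2)
      \<le> 32 * C * (energy (Suc k) v / sqrt (real (Suc k))) + 64 * C\<^sup>2 / real (Suc k) * V" for k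
  proof -
    have "(\<Sum>n<Suc (Suc k). (cmod (v n))\<^sup>2) \<le> V"
      unfolding V_def using assms(1) by (intro sum_le_suminf) (auto simp: ell2_def)
    then have "64 * C\<^sup>2 / real (Suc k) * (\<Sum>n<Suc (Suc k). (cmod (v n))\<^sup>2) \<le> 64 * C\<^sup>2 / real (Suc k) * V"
      by (intro mult_left_mono) auto
    moreover have "0 \<le> (\<Sum>n<Suc (Suc k). (cmod (commutator (Suc k) v n))\<^sup>2)"
      by (intro sum_nonneg) auto
    ultimately show ?thesis
      using commutator_sum_le[of "Suc k" v] unfolding eq by simp
  qed
  then show ?thesis
    using lim by (metis (no_types, lifting) Lim_null_comparison always_eventually)
qed

text \<open>The cutoffs \<open>x k\<close> of \<open>v\<close> converge to \<open>v\<close>, and their images differ from the image of \<open>v\<close> by the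
  commutator and by the cutoff error of the image; both vanish in the limit.\<close>

lemma finite_support_core: "J_max a b \<subseteq> closure_graph (J_min a b)"
proof clarify
  fix v f assume "(v, f) \<in> J_max a b"
  then have v: "v \<in> ell2" and f: "f = jacobi_apply a b v" "f \<in> ell2"
    by (auto simp: J_max_def)
  define x where "x k m = of_real (cutoff (Suc k) m) * v m" for k m
  define \<theta> where "\<theta> k n = (1 - cutoff (Suc k) n)\<^sup>2" for k n
  have "(\<lambda>k. (1 - cutoff (Suc k) n)\<^sup>2) \<longlonglongrightarrow> (1 - 1)\<^sup>2" for n
    by (intro tendsto_intros cutoff_tendsto_1)
  then have \<theta>: "0 \<le> \<theta> k n" "\<theta> k n \<le> 1" "(\<lambda>k. \<theta> k n) \<longlonglongrightarrow> 0" for k n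
    using cutoff_bounds[of "Suc k" n] by (auto simp: \<theta>_def power_le_one)
  have "x k m = 0" if "m \<ge> Suc k" for k m
    using that by (simp add: x_def cutoff_eq_0)
  then have "{m. x k m \<noteq> 0} \<subseteq> {..<Suc k}" for k
    by (metis (mono_tags, lifting) lessThan_iff mem_Collect_eq not_less subsetI)
  then have "finite {m. x k m \<noteq> 0}" for k
    by (rule finite_subset) simp
  then have "(x k, jacobi_apply a b (x k)) \<in> J_min a b" for k
    by (auto simp: J_min_def)
  moreover have "(\<lambda>k. ell2_norm (\<lambda>n. x k n - v n)) \<longlonglongrightarrow> 0"
  proof -
    have "(cmod (x k n - v n))\<^sup>2 = \<theta> k n * (cmod (v n))\<^sup>2" for k n
    proof -
      have "x k n - v n = of_real (cutoff (Suc k) n - 1) * v n"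
        by (simp add: x_def algebra_simps)
      then show ?thesis
        by (simp only: norm_mult norm_of_real power_mult_distrib power2_abs \<theta>_def power2_commute)
    qed
    moreover have "(\<lambda>k. sqrt (\<Sum>n. \<theta> k n * (cmod (v n))\<^sup>2)) \<longlonglongrightarrow> sqrt 0"
      using v by (intro tendsto_real_sqrt tendsto_weighted_suminf_zero \<theta>) (auto simp: ell2_def)
    ultimately show ?thesis by (simp add: ell2_norm_def)
  qed
  moreover have "(\<lambda>k. ell2_norm (\<lambda>n. jacobi_apply a b (x k) n - f n)) \<longlonglongrightarrow> 0"
  proof -
    define c where "c k n = (cmod (commutator (Suc k) v n))\<^sup>2" for k n
    define t where "t k n = \<theta> k n * (cmod (f n))\<^sup>2" for k n
    have sf: "summable (\<lambda>n. (cmod (f n))\<^sup>2)" using f by (simp add: ell2_def)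
    have t: "\<And>k. summable (t k)" "(\<lambda>k. \<Sum>n. t k n) \<longlonglongrightarrow> 0"
      unfolding t_def using tendsto_weighted_suminf_zero[OF \<theta> sf] by auto
    have c: "summable (c k)" for k
      by (rule summable_finite[of "{..Suc k}"]) (auto simp: c_def commutator_eq_0)
    have le: "(cmod (jacobi_apply a b (x k) n - f n))\<^sup>2 \<le> 2 * c k n + 2 * t k n" for k n
    proof -
      have "jacobi_apply a b (x k) n - f n = commutator (Suc k) v n + of_real (cutoff (Suc k) n - 1) * f n"
        by (simp add: commutator_def x_def[abs_def] f algebra_simps)
      moreover have "(cmod (of_real (cutoff (Suc k) n - 1) * f n))\<^sup>2 = t k n"
        by (simp only: norm_mult norm_of_real power_mult_distrib power2_abs t_def \<theta>_def power2_commute)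
      ultimately show ?thesis unfolding c_def using norm_add_square_le by metis
    qed
    have sle: "summable (\<lambda>n. 2 * c k n + 2 * t k n)" for k
      by (intro summable_add summable_mult c t)
    have sl: "summable (\<lambda>n. (cmod (jacobi_apply a b (x k) n - f n))\<^sup>2)" for k
      by (rule summable_comparison_test'[OF sle[of k], of 0]) (simp add: le)
    have "(\<Sum>n. (cmod (jacobi_apply a b (x k) n - f n))\<^sup>2) \<le> 2 * (\<Sum>n. c k n) + 2 * (\<Sum>n. t k n)" for k
    proof -
      have "(\<Sum>n. (cmod (jacobi_apply a b (x k) n - f n))\<^sup>2) \<le> (\<Sum>n. 2 * c k n + 2 * t k n)"
        by (rule suminf_le) (rule le sl sle)+
      also have "\<dots> = 2 * (\<Sum>n. c k n) + 2 * (\<Sum>n. t k n)"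
        using c t by (simp add: suminf_add[symmetric] suminf_mult summable_mult)
      finally show ?thesis .
    qed
    then have bound: "norm (ell2_norm (\<lambda>n. jacobi_apply a b (x k) n - f n))
        \<le> sqrt (2 * (\<Sum>n. c k n) + 2 * (\<Sum>n. t k n))" for k
      unfolding ell2_norm_def using suminf_nonneg[OF sl[of k]] by simp
    have "(\<lambda>k. \<Sum>n. c k n) \<longlonglongrightarrow> 0"
      unfolding c_def using commutator_tendsto_0 v f by simp
    then have "(\<lambda>k. sqrt (2 * (\<Sum>n. c k n) + 2 * (\<Sum>n. t k n))) \<longlonglongrightarrow> sqrt (2 * 0 + 2 * 0)"
      by (intro tendsto_intros t)
    then show ?thesis
      using bound by (metis (no_types, lifting) Lim_null_comparison always_eventually mult_zero_right add_0 real_sqrt_zero)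
  qed
  ultimately have "\<exists>y. (\<forall>k. (x k, y k) \<in> J_min a b)
      \<and> (\<lambda>k. ell2_norm (\<lambda>n. x k n - v n)) \<longlonglongrightarrow> 0 \<and> (\<lambda>k. ell2_norm (\<lambda>n. y k n - f n)) \<longlonglongrightarrow> 0"
    by (intro exI[of _ "\<lambda>k. jacobi_apply a b (x k)"]) simp
  then show "(v, f) \<in> closure_graph (J_min a b)"
    unfolding closure_graph_def using v f(2) by blast
qed

end

section \<open>Power asymptotics\<close>

lemma bigo_sqrt_imp_bound:
  fixes f :: "nat \<Rightarrow> real"
  assumes "f \<in> O(\<lambda>n. sqrt (real n))"
  shows "\<exists>C. \<forall>n. \<bar>f n\<bar> \<le> C * sqrt (real n + 1)"
proof -
  obtain c where c: "c > 0" "eventually (\<lambda>n. norm (f n) \<le> c * norm (sqrt (real n))) sequentially"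
    using landau_o.bigE[OF assms] by blast
  then obtain N where N: "\<And>n. n \<ge> N \<Longrightarrow> \<bar>f n\<bar> \<le> c * sqrt (real n)"
    by (auto simp: eventually_sequentially)
  define M where "M = (\<Sum>k<N. \<bar>f k\<bar>)"
  have M: "0 \<le> M" by (simp add: M_def sum_nonneg)
  have "\<bar>f n\<bar> \<le> (c + M) * sqrt (real n + 1)" for n
  proof (cases "n < N")
    case True
    then have "\<bar>f n\<bar> \<le> M" unfolding M_def by (intro member_le_sum) auto
    also have "\<dots> \<le> (c + M) * 1" using c by simp
    also have "\<dots> \<le> (c + M) * sqrt (real n + 1)" using c M by (intro mult_left_mono) auto
    finally show ?thesis .
  next
    case False
    then have "\<bar>f n\<bar> \<le> c * sqrt (real n)" using N by simp
    also have "\<dots> \<le> (c + M) * sqrt (real n + 1)" using c M by (intro mult_mono) auto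
    finally show ?thesis .
  qed
  then show ?thesis by blast
qed

text \<open>Subtracting the leading power reduces increments of \<open>a\<close> to increments of that power, and exhibits
  the cancellation between the diagonal and the off-diagonal entries.\<close>

lemma power_expansion_remainder:
  fixes \<sigma> \<alpha> :: real and a r :: "nat \<Rightarrow> real"
  assumes "r \<in> O(\<lambda>n. 1 / real n ^ 2)"
    and "\<forall>\<^sub>F n in sequentially. a n = real n powr \<sigma> * (1 + \<alpha> / real n + r n)"
  shows "(\<lambda>n. a n - real n powr \<sigma>) \<in> O(\<lambda>n. real n powr (\<sigma> - 1))"
proof -
  have linear: "(\<lambda>n. real n powr \<sigma> * (\<alpha> / real n)) \<in> O(\<lambda>n. real n powr (\<sigma> - 1))"
    by (cases "\<alpha> = 0") (simp, real_asymp)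
  have "(\<lambda>n. real n powr \<sigma> * r n) \<in> O(\<lambda>n. real n powr \<sigma> * (1 / real n ^ 2))"
    by (intro landau_o.big.mult_left assms)
  also have "(\<lambda>n. real n powr \<sigma> * (1 / real n ^ 2)) \<in> O(\<lambda>n. real n powr (\<sigma> - 1))"
    by real_asymp
  finally have "(\<lambda>n. real n powr \<sigma> * (\<alpha> / real n) + real n powr \<sigma> * r n) \<in> O(\<lambda>n. real n powr (\<sigma> - 1))"
    by (rule sum_in_bigo(1)[OF linear])
  moreover have "\<forall>\<^sub>F n in sequentially. a n - real n powr \<sigma> = real n powr \<sigma> * (\<alpha> / real n) + real n powr \<sigma> * r n"
    using assms(2) by eventually_elim (simp add: algebra_simps)
  ultimately show ?thesis
    by (simp add: landau_o.big.in_cong)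
qed

text \<open>Asymptotic form of the criterion; the constant of the two growth conditions is enlarged to cover
  the finitely many remaining indices and $a_0$.\<close>

lemma critical_growth_essentially_self_adjoint:
  fixes a b :: "nat \<Rightarrow> real"
  assumes "s * s = 1" "\<And>n. 0 \<le> a n"
    and "(\<lambda>n. a (Suc n) - a n) \<in> O(\<lambda>n. sqrt (real n))"
    and "(\<lambda>n. b n + 2 * s * a n) \<in> O(\<lambda>n. sqrt (real n))"
  shows "essentially_self_adjoint (J_min a b)"
proof -
  obtain C1 where C1: "\<And>n. \<bar>a (Suc n) - a n\<bar> \<le> C1 * sqrt (real n + 1)"
    using bigo_sqrt_imp_bound[OF assms(3)] by auto
  obtain C2 where C2: "\<And>n. \<bar>b n + 2 * s * a n\<bar> \<le> C2 * sqrt (real n + 1)"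
    using bigo_sqrt_imp_bound[OF assms(4)] by auto
  define C where "C = max (max C1 C2) (a 0)"
  have mono: "c * sqrt (real m + 1) \<le> C * sqrt (real n + 1)" if "c \<le> C" "m \<le> n" for c m n
    using that assms(2)[of 0] by (intro mult_mono) (auto simp: C_def)
  have "critical_jacobi a b s C"
  proof
    show "\<bar>a n - prev a n\<bar> \<le> C * sqrt (real n + 1)" for n
    proof (cases n)
      case 0
      then show ?thesis using assms(2)[of 0] by (simp add: C_def)
    next
      case (Suc m)
      then have "C1 * sqrt (real m + 1) \<le> C * sqrt (real n + 1)"
        by (intro mono) (auto simp: C_def)
      moreover have "\<bar>a n - prev a n\<bar> \<le> C1 * sqrt (real m + 1)"
        using C1[of m] Suc by simp
      ultimately show ?thesis by linarith
    qed
    show "\<bar>b n + 2 * s * a n\<bar> \<le> C * sqrt (real n + 1)" for n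
      using C2[of n] mono[of C2 n n] unfolding C_def by linarith
  qed (use assms in auto)
  then show ?thesis
    using critical_jacobi.finite_support_core essentially_self_adjoint_if_core by blast
qed

theorem proposition2p9:
  fixes \<gamma> \<sigma> \<alpha> \<beta> \<tau> :: real and a b ra rb :: "nat \<Rightarrow> real"
  assumes "\<gamma> \<in> {1, -1}"
    and "0 < \<sigma>" and "\<sigma> \<le> 3 / 2"
    and "\<And>n. a n > 0"
    and "ra \<in> O(\<lambda>n. 1 / real n ^ 2)"
    and "\<forall>\<^sub>F n in sequentially. a n = real n powr \<sigma> * (1 + \<alpha> / real n + ra n)"
    and "rb \<in> O(\<lambda>n. 1 / real n ^ 2)"
    and "\<forall>\<^sub>F n in sequentially. b n = 2 * \<gamma> * real n powr \<sigma> * (1 + \<beta> / real n + rb n)"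
    and "\<tau> = 2 * \<beta> - 2 * \<alpha> + \<sigma>"
    and "\<sigma> > 1 \<Longrightarrow> \<tau> \<noteq> 0"
  shows "essentially_self_adjoint (J_min a b)"
proof (rule critical_growth_essentially_self_adjoint)
  have \<gamma>: "\<gamma> * \<gamma> = 1" using assms(1) by auto
  then show "(- \<gamma>) * (- \<gamma>) = 1" by simp
  show "0 \<le> a n" for n using assms(4)[of n] by simp
  have half: "(\<lambda>n. real n powr (\<sigma> - 1)) \<in> O(\<lambda>n. sqrt (real n))"
  proof (rule bigoI[where c = 1])
    show "\<forall>\<^sub>F n in sequentially. norm (real n powr (\<sigma> - 1)) \<le> 1 * norm (sqrt (real n))"
      using eventually_ge_at_top[of 1]
    proof eventually_elim
      case (elim n)
      have "real n powr (\<sigma> - 1) \<le> real n powr (1 / 2)"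
        using elim assms(3) by (intro powr_mono) auto
      then show ?case by (simp add: powr_half_sqrt)
    qed
  qed
  have a: "(\<lambda>n. a n - real n powr \<sigma>) \<in> O(\<lambda>n. real n powr (\<sigma> - 1))"
    by (rule power_expansion_remainder[OF assms(5,6)])
  have "(\<lambda>n. a (Suc n) - real (Suc n) powr \<sigma>) \<in> O(\<lambda>n. real (Suc n) powr (\<sigma> - 1))"
    using landau_o.big.compose[OF a filterlim_Suc] .
  also have "(\<lambda>n. real (Suc n) powr (\<sigma> - 1)) \<in> O(\<lambda>n. real n powr (\<sigma> - 1))"
    by real_asymp
  finally have a': "(\<lambda>n. a (Suc n) - real (Suc n) powr \<sigma>) \<in> O(\<lambda>n. real n powr (\<sigma> - 1))" .
  have step: "(\<lambda>n. real (Suc n) powr \<sigma> - real n powr \<sigma>) \<in> O(\<lambda>n. real n powr (\<sigma> - 1))"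
    using assms(2) by real_asymp
  have "(\<lambda>n. (a (Suc n) - real (Suc n) powr \<sigma>) + (real (Suc n) powr \<sigma> - real n powr \<sigma>)
      - (a n - real n powr \<sigma>)) \<in> O(\<lambda>n. real n powr (\<sigma> - 1))"
    by (intro sum_in_bigo a a' step)
  then show "(\<lambda>n. a (Suc n) - a n) \<in> O(\<lambda>n. sqrt (real n))"
    using landau_o.big_trans[OF _ half] by simp
  \<comment> \<open>Since $\gamma^2 = 1$, the sequence $\gamma b_n / 2$ has an expansion of the same form as $a_n$;
    the leading powers cancel in the difference.\<close>
  have "\<forall>\<^sub>F n in sequentially. \<gamma> * b n / 2 = real n powr \<sigma> * (1 + \<beta> / real n + rb n)"
    using assms(8)
  proof eventually_elim
    case (elim n)
    have "\<gamma> * b n / 2 = (\<gamma> * \<gamma>) * (real n powr \<sigma> * (1 + \<beta> / real n + rb n))"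
      unfolding elim by (simp add: mult_ac)
    then show ?case by (simp add: \<gamma>)
  qed
  from sum_in_bigo(2)[OF power_expansion_remainder[OF assms(7) this] a]
  have "(\<lambda>n. 2 * \<gamma> * ((\<gamma> * b n / 2 - real n powr \<sigma>) - (a n - real n powr \<sigma>))) \<in> O(\<lambda>n. real n powr (\<sigma> - 1))"
    using \<gamma> by (subst landau_o.big.cmult_in_iff) auto
  moreover have "2 * \<gamma> * ((\<gamma> * b n / 2 - real n powr \<sigma>) - (a n - real n powr \<sigma>)) = b n + 2 * (- \<gamma>) * a n" for n
  proof -
    have "2 * \<gamma> * ((\<gamma> * b n / 2 - real n powr \<sigma>) - (a n - real n powr \<sigma>)) = (\<gamma> * \<gamma>) * b n - 2 * \<gamma> * a n"
      by (simp add: algebra_simps)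
    then show ?thesis by (simp add: \<gamma>)
  qed
  ultimately have "(\<lambda>n. b n + 2 * (- \<gamma>) * a n) \<in> O(\<lambda>n. real n powr (\<sigma> - 1))"
    by (simp only:)
  then show "(\<lambda>n. b n + 2 * (- \<gamma>) * a n) \<in> O(\<lambda>n. sqrt (real n))"
    by (rule landau_o.big_trans[OF _ half])
qed

end
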